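(* For $k=1,2,\ldots,s$, let $x_k^{tsvd}$ denote the solution of $$\min\|x\|\quad\text{subject to}\quad \|A_kx-b\|=\min ,$$ that is, the minimum 2-norm minimizer of $\|A_kx-b\|$ over $x\in\mathbb{R}^n$. Then for $k=1,2,\ldots,s$, $$x_k^{tsvd}=A_k^{\dagger}b=(A_k^{\prime})^{\dagger}b,$$ $$\|Ax_k^{tsvd}-b\|=\|A_kx_k^{tsvd}-b\|=\|A_k^{\prime}x_k^{tsvd}-b\|=\|A^{\prime}x_k^{tsvd}-b\|.$$ In particular, for $k=s$, $$x_{naive}=x_s^{tsvd}=A^{\dagger}b=(A^{\prime})^{\dagger}b .$$ Consequently, for each $k=1,2,\ldots,s$, the problem $\min\|x\|$ subject to $\|A_kx-b\|=\min$ and the problem $\min\|x\|$ subject to $\|A_k^{\prime}x-b\|=\min$ have the same solution and the same residual norm.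
   Context: $\|\cdot\|$ is the 2-norm and $\dagger$ denotes the Moore-Penrose inverse. Let $m\ge n$ and let $A\in\mathbb{R}^{m\times n}$ have the SVD $$A=\widehat U\begin{pmatrix}\Sigma\\ \mathbf 0\end{pmatrix}\widehat V^T,\qquad \Sigma=\mathrm{diag}(\sigma_1I_{c_1},\ldots,\sigma_sI_{c_s}),$$ with $\sigma_1>\sigma_2>\cdots>\sigma_s>0$ the distinct singular values, $\sigma_i$ of multiplicity $c_i$, $c_1+\cdots+c_s=n$, and $\widehat U=(\widehat U_1,\ldots,\widehat U_s,\widehat U_\perp)\in\mathbb{R}^{m\times m}$, $\widehat V=(\widehat V_1,\ldots,\widehat V_s)\in\mathbb{R}^{n\times n}$ orthogonal, $\widehat U_i\in\mathbb{R}^{m\times c_i}$, $\widehat V_i\in\mathbb{R}^{n\times c_i}$. Let $b\in\mathbb{R}^m$ with $\widehat U_i^Tb\neq 0$ for $i=1,\ldots,s$. Put $x_{naive}=A^\dagger b$ and $$A_k=(\widehat U_1,\ldots,\widehat U_k)\,\mathrm{diag}(\sigma_1I_{c_1},\ldots,\sigma_kI_{c_k})\,(\widehat V_1,\ldots,\widehat V_k)^T .$$ Define $$u_i=\frac{\widehat U_i\widehat U_i^Tb}{\|\widehat U_i^Tb\|},\qquad v_i=\frac{A^Tu_i}{\sigma_i},\qquad i=1,\ldots,s.$$ For each $i$ complete $u_i$ to an orthonormal basis of the column space of $\widehat U_i$, and map the additional $c_i-1$ vectors $u$ to $A^Tu/\sigma_i$, so that together with $v_i$ these form an orthonormal basis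 of the column space of $\widehat V_i$. Let $U_\perp\in\mathbb{R}^{m\times(n-s)}$ and $V_\perp\in\mathbb{R}^{n\times(n-s)}$ collect all the additional left and right vectors, let $U=(u_1,\ldots,u_s,U_\perp)$, $V=(v_1,\ldots,v_s,V_\perp)$, and define $$A^{\prime}=U\,\mathrm{diag}(\sigma_1,\ldots,\sigma_s,0,\ldots,0)\,V^T\in\mathbb{R}^{m\times n},\qquad A_k^{\prime}=(u_1,\ldots,u_k)\,\mathrm{diag}(\sigma_1,\ldots,\sigma_k)\,(v_1,\ldots,v_k)^T .$$ *)

theory Defs
  imports Complex_Main "Jordan_Normal_Form.VS_Connect"
begin

definition vnorm :: "real vec \<Rightarrow> real" where
  "vnorm v = sqrt (v \<bullet> v)"

text \<open>The library predicate \<open>orthogonal_mat\<close> only asks for pairwise orthogonal nonzero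
  columns; here the columns are also normalized and the matrix is square.\<close>

definition orthonormal_square_mat :: "real mat \<Rightarrow> bool" where
  "orthonormal_square_mat Q \<longleftrightarrow>
     square_mat Q \<and> transpose_mat Q * Q = 1\<^sub>m (dim_row Q) \<and> Q * transpose_mat Q = 1\<^sub>m (dim_row Q)"

definition orthonormal_vecs :: "real vec list \<Rightarrow> bool" where
  "orthonormal_vecs vs \<longleftrightarrow>
     (\<forall>i < length vs. \<forall>j < length vs. vs ! i \<bullet> vs ! j = (if i = j then 1 else 0))"

definition orthonormal_basis_of_col_space :: "nat \<Rightarrow> real vec list \<Rightarrow> real mat \<Rightarrow> bool" where
  "orthonormal_basis_of_col_space m vs M \<longleftrightarrow>
     set vs \<subseteq> carrier_vec m \<and> orthonormal_vecs vs \<and>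
     LinearCombinations.module.span class_ring (module_vec TYPE(real) m) (set vs)
       = vec_space.col_space m M"

text \<open>Horizontal concatenation \<open>(M\<^sub>1, M\<^sub>2, \<dots>)\<close> of matrices with \<open>m\<close> rows.\<close>

definition hcat :: "nat \<Rightarrow> real mat list \<Rightarrow> real mat" where
  "hcat m Ms = mat_of_cols m (concat (map cols Ms))"

text \<open>\<open>diag (\<sigma>\<^sub>1 I, \<dots>, \<sigma>\<^sub>k I)\<close>, where the \<open>i\<close>-th identity matrix has size \<open>c i\<close>.\<close>

definition scalar_blocks :: "(nat \<Rightarrow> nat) \<Rightarrow> (nat \<Rightarrow> real) \<Rightarrow> nat \<Rightarrow> real mat" where
  "scalar_blocks c \<sigma> k = diag_block_mat (map (\<lambda>i. \<sigma> i \<cdot>\<^sub>m 1\<^sub>m (c i)) [1..<Suc k])"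

text \<open>The Moore-Penrose inverse is the unique matrix satisfying the four Penrose equations.\<close>

definition is_moore_penrose :: "real mat \<Rightarrow> real mat \<Rightarrow> bool" where
  "is_moore_penrose A X \<longleftrightarrow>
     X \<in> carrier_mat (dim_col A) (dim_row A) \<and>
     A * X * A = A \<and> X * A * X = X \<and>
     transpose_mat (A * X) = A * X \<and> transpose_mat (X * A) = X * A"

definition pinv :: "real mat \<Rightarrow> real mat" where
  "pinv A = (THE X. is_moore_penrose A X)"

definition lsq_minimizer :: "real mat \<Rightarrow> real vec \<Rightarrow> real vec \<Rightarrow> bool" where
  "lsq_minimizer B b x \<longleftrightarrow>
     x \<in> carrier_vec (dim_col B) \<and>
     (\<forall>y \<in> carrier_vec (dim_col B). vnorm (B *\<^sub>v x - b) \<le> vnorm (B *\<^sub>v y - b))"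

definition min_norm_lsq :: "real mat \<Rightarrow> real vec \<Rightarrow> real vec \<Rightarrow> bool" where
  "min_norm_lsq B b x \<longleftrightarrow>
     lsq_minimizer B b x \<and> (\<forall>y. lsq_minimizer B b y \<longrightarrow> vnorm x \<le> vnorm y)"

definition min_norm_lsq_sol :: "real mat \<Rightarrow> real vec \<Rightarrow> real vec" where
  "min_norm_lsq_sol B b = (THE x. min_norm_lsq B b x)"

end

theory Submission
  imports Defs
begin

text \<open>
  All matrices involved are sums \<open>\<Sum>\<^sub>i \<sigma>\<^sub>i P\<^sub>i Q\<^sub>i\<^sup>T\<close> over mutually orthonormal blocks \<open>P\<^sub>i\<close>, \<open>Q\<^sub>i\<close>.
  Such sums multiply coefficientwise, so inverting the coefficients and swapping \<open>P\<close> with \<open>Q\<close>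
  gives the Moore-Penrose inverse. Since \<open>u\<^sub>i\<close> spans the projection of \<open>b\<close> onto the range
  of the \<open>i\<close>-th left block, replacing the blocks by the single columns \<open>u\<^sub>i\<close>, \<open>v\<^sub>i\<close> does not change
  any term once it is applied to \<open>b\<close>.
\<close>

section \<open>Moore-Penrose inverses and least squares\<close>

text \<open>As soon as a block has more than one column, the matrices with and without a prime have
  different ranks, so neither they nor their Moore-Penrose inverses can be identified. All
  comparisons are therefore made at vectors: the inverses at \<open>b\<close>, the matrices at the
  solution. The two systems are linked by one unit vector per block: \<open>u i\<close> and
  \<open>v i\<close> have the same coordinates \<open>w i\<close>, one with respect to
  \<open>Uh i\<close>, the other with respect to \<open>Vh i\<close>. The four residual norms agree
  because the four images of the solution already coincide: the solution only involves the first
  \<open>k\<close> right blocks, and there the full and the truncated matrices act alike. Both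
  \<open>pinv\<close> and \<open>min_norm_lsq_sol\<close> are definite descriptions. Their values
  become available only through existence and uniqueness, so an explicit inverse is exhibited for
  each matrix and every minimizer is characterized.\<close>

lemma scalar_prod_self_nonneg:
  fixes v :: "real vec"
  shows "0 \<le> v \<bullet> v"
  unfolding scalar_prod_def by (intro sum_nonneg) simp

lemma scalar_prod_self_eq_0:
  fixes v :: "real vec"
  assumes "v \<in> carrier_vec n" "v \<bullet> v = 0"
  shows "v = 0\<^sub>v n"
proof -
  have "v $ i * v $ i = 0" if "i < n" for i
    using assms that unfolding scalar_prod_def
    by (subst (asm) sum_nonneg_eq_0_iff) auto
  then show ?thesis using assms(1) by (intro eq_vecI) auto
qed

lemma vnorm_le_iff: "vnorm v \<le> vnorm w \<longleftrightarrow> v \<bullet> v \<le> w \<bullet> w"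
  unfolding vnorm_def by simp

lemma vnorm_sq: "vnorm v * vnorm v = v \<bullet> v"
  unfolding vnorm_def using scalar_prod_self_nonneg by simp

lemma scalar_prod_self_add_orthogonal:
  fixes v w :: "real vec"
  assumes "v \<in> carrier_vec n" "w \<in> carrier_vec n" "v \<bullet> w = 0"
  shows "(v + w) \<bullet> (v + w) = v \<bullet> v + w \<bullet> w"
proof -
  have "w \<bullet> v = 0" using assms comm_scalar_prod[of v n w] by simp
  then show ?thesis
    using assms by (simp add: add_scalar_prod_distrib[of _ n] scalar_prod_add_distrib[of _ n])
qed

text \<open>\<open>B * X\<close> and \<open>B * Y\<close> are both the orthogonal projection onto
  the range of \<open>B\<close>, and \<open>X * B\<close> and \<open>Y * B\<close> both the one onto
  its row space. Equal projections give
  \<open>X = X * B * X = Y * B * X = Y * B * Y = Y\<close>.\<close>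

lemma is_moore_penrose_unique:
  assumes X: "is_moore_penrose B X" and Y: "is_moore_penrose B Y"
  shows "X = Y"
proof -
  obtain m n where B: "B \<in> carrier_mat m n" by blast
  have Xc: "X \<in> carrier_mat n m" and Yc: "Y \<in> carrier_mat n m"
    using X Y B unfolding is_moore_penrose_def by auto
  have X1: "B * X * B = B" and X2: "X * B * X = X"
    and X3: "transpose_mat (B * X) = B * X" and X4: "transpose_mat (X * B) = X * B"
    using X unfolding is_moore_penrose_def by blast+
  have Y1: "B * Y * B = B" and Y2: "Y * B * Y = Y"
    and Y3: "transpose_mat (B * Y) = B * Y" and Y4: "transpose_mat (Y * B) = Y * B"
    using Y unfolding is_moore_penrose_def by blast+
  have BXc: "B * X \<in> carrier_mat m m" and BYc: "B * Y \<in> carrier_mat m m"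
    and XBc: "X * B \<in> carrier_mat n n" and YBc: "Y * B \<in> carrier_mat n n"
    using B Xc Yc by simp_all
  have "B * Y = B * X * (B * Y)"
    using assoc_mult_mat[OF BXc B Yc] unfolding X1 .
  also have "\<dots> = transpose_mat (B * Y * (B * X))"
    unfolding transpose_mult[OF BYc BXc] X3 Y3 ..
  also have "B * Y * (B * X) = B * X"
    using assoc_mult_mat[OF BYc B Xc] unfolding Y1 by (rule sym)
  finally have BY: "B * Y = B * X" unfolding X3 .
  have "X * B = X * (B * Y * B)" unfolding Y1 ..
  also have "\<dots> = X * B * (Y * B)"
    unfolding assoc_mult_mat[OF B Yc B] assoc_mult_mat[OF Xc B YBc] ..
  also have "\<dots> = transpose_mat (Y * B * (X * B))"
    unfolding transpose_mult[OF YBc XBc] X4 Y4 ..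
  also have "Y * B * (X * B) = Y * (B * X * B)"
    unfolding assoc_mult_mat[OF B Xc B] assoc_mult_mat[OF Yc B XBc] ..
  finally have XB: "X * B = Y * B" unfolding X1 Y4 .
  have "X = Y * B * X" using X2 unfolding XB by (rule sym)
  also have "\<dots> = Y * (B * X)" by (rule assoc_mult_mat[OF Yc B Xc])
  also have "\<dots> = Y * B * Y" unfolding BY[symmetric] assoc_mult_mat[OF Yc B Yc] ..
  also have "\<dots> = Y" by (rule Y2)
  finally show ?thesis .
qed

lemma pinv_eqI: "is_moore_penrose B X \<Longrightarrow> pinv B = X"
  unfolding pinv_def using is_moore_penrose_unique by blast

text \<open>Pythagoras: changing \<open>y\<close> moves the image only within the range of
  \<open>B\<close>, to which the residual at \<open>X *\<^sub>v b\<close> is orthogonal.\<close>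

lemma lsq_residual_decomp:
  assumes B: "B \<in> carrier_mat m n" and X: "is_moore_penrose B X"
    and b: "b \<in> carrier_vec m" and y: "y \<in> carrier_vec n"
  shows "(B *\<^sub>v y - b) \<bullet> (B *\<^sub>v y - b) =
    (B *\<^sub>v (X *\<^sub>v b) - b) \<bullet> (B *\<^sub>v (X *\<^sub>v b) - b)
    + (B *\<^sub>v y - B *\<^sub>v (X *\<^sub>v b)) \<bullet> (B *\<^sub>v y - B *\<^sub>v (X *\<^sub>v b))"
proof -
  have Xc: "X \<in> carrier_mat n m" using X B unfolding is_moore_penrose_def by auto
  let ?x = "X *\<^sub>v b"
  let ?r = "B *\<^sub>v ?x - b"
  have xc: "?x \<in> carrier_vec n" and rc: "?r \<in> carrier_vec m" using B Xc b by auto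
  have BX: "B * X \<in> carrier_mat m m" using B Xc by simp
  \<comment> \<open>The normal equations: symmetry of \<open>B * X\<close> turns the left side into
    the transpose of \<open>B * X * B\<close>, which is \<open>B\<close>.\<close>
  have "transpose_mat B *\<^sub>v (B *\<^sub>v ?x) = transpose_mat B *\<^sub>v (transpose_mat (B * X) *\<^sub>v b)"
    using X B Xc b unfolding is_moore_penrose_def by simp
  also have "\<dots> = transpose_mat (B * X * B) *\<^sub>v b"
    using B BX b by (simp add: transpose_mult[OF BX B] del: assoc_mult_mat)
  also have "B * X * B = B" using X unfolding is_moore_penrose_def by simp
  finally have "transpose_mat B *\<^sub>v ?r = 0\<^sub>v n"
    using B xc b by (simp add: mult_minus_distrib_mat_vec[of _ n m])
  then have "?r \<bullet> (B *\<^sub>v (y - ?x)) = 0"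
    using transpose_vec_mult_scalar[OF B _ rc, of "y - ?x"] y xc by simp
  moreover have "B *\<^sub>v (y - ?x) = B *\<^sub>v y - B *\<^sub>v ?x"
    using B y xc by (simp add: mult_minus_distrib_mat_vec[of _ m n])
  moreover have "B *\<^sub>v y - b = ?r + (B *\<^sub>v y - B *\<^sub>v ?x)"
    using B y xc b by (intro eq_vecI) auto
  ultimately show ?thesis
    using scalar_prod_self_add_orthogonal[OF rc, of "B *\<^sub>v y - B *\<^sub>v ?x"] B y xc by simp
qed

text \<open>Only the last summand of the decomposition depends on \<open>y\<close>, so minimality
  forces it to vanish.\<close>

lemma lsq_minimizer_iff:
  assumes B: "B \<in> carrier_mat m n" and X: "is_moore_penrose B X"
    and b: "b \<in> carrier_vec m"
  shows "lsq_minimizer B b y \<longleftrightarrow> y \<in> carrier_vec n \<and> B *\<^sub>v y = B *\<^sub>v (X *\<^sub>v b)"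
proof -
  have Xc: "X \<in> carrier_mat n m" using X B unfolding is_moore_penrose_def by auto
  let ?x = "X *\<^sub>v b"
  have xc: "?x \<in> carrier_vec n" using Xc b by auto
  note dec = lsq_residual_decomp[OF B X b]
  have n: "dim_col B = n" using B by simp
  show ?thesis
  proof
    assume L: "lsq_minimizer B b y"
    then have y: "y \<in> carrier_vec n" unfolding lsq_minimizer_def n by simp
    let ?d = "B *\<^sub>v y - B *\<^sub>v ?x"
    have "?d \<bullet> ?d \<le> 0"
      using L xc dec[OF y] unfolding lsq_minimizer_def n vnorm_le_iff by auto
    then have "?d = 0\<^sub>v m"
      using scalar_prod_self_nonneg[of ?d] scalar_prod_self_eq_0[of ?d m] B y xc by simp
    moreover have "B *\<^sub>v y = ?d + B *\<^sub>v ?x" using B y xc by (intro eq_vecI) auto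
    ultimately have "B *\<^sub>v y = B *\<^sub>v ?x" using B xc by simp
    with y show "y \<in> carrier_vec n \<and> B *\<^sub>v y = B *\<^sub>v ?x" by simp
  next
    assume "y \<in> carrier_vec n \<and> B *\<^sub>v y = B *\<^sub>v ?x"
    then show "lsq_minimizer B b y"
      unfolding lsq_minimizer_def n vnorm_le_iff using dec scalar_prod_self_nonneg by auto
  qed
qed

text \<open>A minimizer differs from \<open>X *\<^sub>v b\<close> by a kernel vector of
  \<open>B\<close>. The symmetric matrix \<open>X * B\<close> fixes \<open>X *\<^sub>v b\<close> and
  kills that difference, so the two are orthogonal, and Pythagoras singles out
  \<open>X *\<^sub>v b\<close>.\<close>

lemma min_norm_lsq_iff:
  assumes B: "B \<in> carrier_mat m n" and X: "is_moore_penrose B X"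
    and b: "b \<in> carrier_vec m"
  shows "min_norm_lsq B b x \<longleftrightarrow> x = X *\<^sub>v b"
proof -
  have Xc: "X \<in> carrier_mat n m" using X B unfolding is_moore_penrose_def by auto
  let ?x = "X *\<^sub>v b"
  have xc: "?x \<in> carrier_vec n" using Xc b by auto
  note lsq = lsq_minimizer_iff[OF B X b]
  have dec: "y \<bullet> y = ?x \<bullet> ?x + (y - ?x) \<bullet> (y - ?x)" if "lsq_minimizer B b y" for y
  proof -
    from that lsq have y: "y \<in> carrier_vec n" and By: "B *\<^sub>v y = B *\<^sub>v ?x" by auto
    have d: "y - ?x \<in> carrier_vec n" using y xc by simp
    have XB: "X * B \<in> carrier_mat n n" using B Xc by simp
    have "(X * B) *\<^sub>v (y - ?x) = X *\<^sub>v (B *\<^sub>v y - B *\<^sub>v ?x)"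
      using B Xc y xc by (simp add: mult_minus_distrib_mat_vec[of _ m n])
    also have "\<dots> = 0\<^sub>v n" using By B Xc xc
      by (auto simp: mult_minus_distrib_mat_vec[of _ n m] minus_cancel_vec)
    finally have "?x \<bullet> ((X * B) *\<^sub>v (y - ?x)) = 0" using xc by simp
    then have "(transpose_mat (X * B) *\<^sub>v ?x) \<bullet> (y - ?x) = 0"
      using transpose_vec_mult_scalar[OF XB d xc] by simp
    moreover have "transpose_mat (X * B) *\<^sub>v ?x = ?x"
      using X assoc_mult_mat_vec[OF XB Xc b] unfolding is_moore_penrose_def by simp
    ultimately have "?x \<bullet> (y - ?x) = 0" by simp
    moreover have "y = ?x + (y - ?x)" using y Xc b by (intro eq_vecI) auto
    ultimately show ?thesis using scalar_prod_self_add_orthogonal[OF xc d] by simp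
  qed
  have lx: "lsq_minimizer B b ?x" using lsq xc by simp
  show ?thesis
  proof
    assume M: "min_norm_lsq B b x"
    then have l: "lsq_minimizer B b x" and "vnorm x \<le> vnorm ?x"
      using lx unfolding min_norm_lsq_def by auto
    then have "(x - ?x) \<bullet> (x - ?x) = 0"
      using dec[OF l] scalar_prod_self_nonneg[of "x - ?x"] unfolding vnorm_le_iff by simp
    moreover have x: "x \<in> carrier_vec n" using l lsq by simp
    ultimately have z: "x - ?x = 0\<^sub>v n" using xc scalar_prod_self_eq_0[of "x - ?x" n] by simp
    have "x = (x - ?x) + ?x" using x Xc b by (intro eq_vecI) auto
    then show "x = ?x" unfolding z using xc by simp
  next
    have "vnorm ?x \<le> vnorm y" if "lsq_minimizer B b y" for y
      using dec[OF that] scalar_prod_self_nonneg[of "y - ?x"] unfolding vnorm_le_iff by linarith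
    moreover assume "x = ?x"
    ultimately show "min_norm_lsq B b x" using lx unfolding min_norm_lsq_def by blast
  qed
qed

lemma min_norm_lsq_sol_eq_pinv:
  assumes "B \<in> carrier_mat m n" "is_moore_penrose B X" "b \<in> carrier_vec m"
  shows "\<exists>!x. min_norm_lsq B b x" "min_norm_lsq_sol B b = pinv B *\<^sub>v b"
  using min_norm_lsq_iff[OF assms] pinv_eqI[OF assms(2)]
  unfolding min_norm_lsq_sol_def by auto

section \<open>Sums of orthonormal blocks\<close>

text \<open>The sizes \<open>m\<close> and \<open>n\<close> are arguments because the empty sum must
  still have a shape. Recursion on \<open>k\<close> mirrors appending a last block to a
  concatenation.\<close>

fun block_sum :: "nat \<Rightarrow> nat \<Rightarrow> (nat \<Rightarrow> real) \<Rightarrow> (nat \<Rightarrow> real mat) \<Rightarrow> (nat \<Rightarrow> real mat)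
    \<Rightarrow> nat \<Rightarrow> real mat" where
  "block_sum m n \<sigma> P Q 0 = 0\<^sub>m m n"
| "block_sum m n \<sigma> P Q (Suc k) =
     block_sum m n \<sigma> P Q k + \<sigma> (Suc k) \<cdot>\<^sub>m (P (Suc k) * transpose_mat (Q (Suc k)))"

definition blocks :: "nat \<Rightarrow> (nat \<Rightarrow> nat) \<Rightarrow> nat \<Rightarrow> (nat \<Rightarrow> real mat) \<Rightarrow> bool" where
  "blocks m c s P \<longleftrightarrow> (\<forall>i \<in> {1..s}. P i \<in> carrier_mat m (c i))"

text \<open>The widths form a parameter \<open>c\<close>, so that the given blocks and the single
  columns, with \<open>c\<close> constantly 1, fall under the same lemmas.\<close>

definition orthonormal_blocks :: "nat \<Rightarrow> (nat \<Rightarrow> nat) \<Rightarrow> nat \<Rightarrow> (nat \<Rightarrow> real mat) \<Rightarrow> bool" where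
  "orthonormal_blocks m c s P \<longleftrightarrow> blocks m c s P \<and>
     (\<forall>i \<in> {1..s}. \<forall>j \<in> {1..s}.
       transpose_mat (P i) * P j = (if i = j then 1\<^sub>m (c i) else 0\<^sub>m (c i) (c j)))"

lemma blocks_mono: "blocks m c s P \<Longrightarrow> k \<le> s \<Longrightarrow> blocks m c k P"
  unfolding blocks_def by auto

lemma orthonormal_blocks_mono:
  "orthonormal_blocks m c s P \<Longrightarrow> k \<le> s \<Longrightarrow> orthonormal_blocks m c k P"
  unfolding orthonormal_blocks_def using blocks_mono by auto

lemma orthonormal_blocksD: "orthonormal_blocks m c s P \<Longrightarrow> blocks m c s P"
  unfolding orthonormal_blocks_def by simp

lemma blocks_SucD:
  assumes "blocks m c (Suc k) P"
  shows "blocks m c k P" "P (Suc k) \<in> carrier_mat m (c (Suc k))"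
  using assms unfolding blocks_def by auto

lemma block_sum_carrier:
  "blocks m c k P \<Longrightarrow> blocks n c k Q \<Longrightarrow> block_sum m n \<sigma> P Q k \<in> carrier_mat m n"
proof (induction k)
  case (Suc k)
  note P = blocks_SucD[OF Suc.prems(1)] and Q = blocks_SucD[OF Suc.prems(2)]
  show ?case using Suc.IH[OF P(1) Q(1)] P(2) Q(2) by simp
qed simp

lemma transpose_block_sum:
  "blocks m c k P \<Longrightarrow> blocks n c k Q \<Longrightarrow>
    transpose_mat (block_sum m n \<sigma> P Q k) = block_sum n m \<sigma> Q P k"
proof (induction k)
  case (Suc k)
  note P = blocks_SucD[OF Suc.prems(1)] and Q = blocks_SucD[OF Suc.prems(2)]
  have PQ: "P (Suc k) * transpose_mat (Q (Suc k)) \<in> carrier_mat m n" using P Q by auto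
  have "transpose_mat (\<sigma> (Suc k) \<cdot>\<^sub>m (P (Suc k) * transpose_mat (Q (Suc k))))
      = \<sigma> (Suc k) \<cdot>\<^sub>m transpose_mat (P (Suc k) * transpose_mat (Q (Suc k)))"
    by (intro eq_matI) auto
  also have "\<dots> = \<sigma> (Suc k) \<cdot>\<^sub>m (Q (Suc k) * transpose_mat (P (Suc k)))"
    using P Q by (subst transpose_mult[of _ m "c (Suc k)" _ n]) auto
  finally show ?case
    using Suc.IH[OF P(1) Q(1)] block_sum_carrier[OF P(1) Q(1)] PQ
    by (simp add: transpose_add[of _ m n])
qed simp

lemma block_sum_cong:
  assumes "\<And>i. i \<in> {1..k} \<Longrightarrow> \<sigma> i = \<tau> i"
  shows "block_sum m n \<sigma> P Q k = block_sum m n \<tau> P Q k"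
  using assms by (induction k) auto

text \<open>Orthogonality removes every term but the \<open>i\<close>-th. The case
  \<open>k < i\<close> is included because the induction on \<open>k\<close> passes through sums
  that do not yet contain that term.\<close>

lemma block_sum_mult_block:
  assumes "blocks m c s P" "orthonormal_blocks n c s Q" "k \<le> s" "i \<in> {1..s}"
  shows "block_sum m n \<sigma> P Q k * Q i = (if i \<le> k then \<sigma> i \<cdot>\<^sub>m P i else 0\<^sub>m m (c i))"
  using assms(3)
proof (induction k)
  case 0
  have "Q i \<in> carrier_mat n (c i)"
    using assms(2,4) unfolding orthonormal_blocks_def blocks_def by blast
  then show ?case using assms(4) by simp
next
  case (Suc k)
  have P: "blocks m c k P" and Q: "blocks n c k Q"
    using Suc.prems assms(1,2) by (auto intro: blocks_mono orthonormal_blocksD)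
  note S = block_sum_carrier[OF P Q, of \<sigma>]
  have Pk: "P (Suc k) \<in> carrier_mat m (c (Suc k))" and Qk: "Q (Suc k) \<in> carrier_mat n (c (Suc k))"
    and Pi: "P i \<in> carrier_mat m (c i)" and Qi: "Q i \<in> carrier_mat n (c i)"
    using Suc.prems assms unfolding orthonormal_blocks_def blocks_def by auto
  have Qki: "transpose_mat (Q (Suc k)) * Q i
      = (if Suc k = i then 1\<^sub>m (c i) else 0\<^sub>m (c (Suc k)) (c i))"
    using Suc.prems assms unfolding orthonormal_blocks_def by auto
  have "\<sigma> (Suc k) \<cdot>\<^sub>m (P (Suc k) * transpose_mat (Q (Suc k))) * Q i
      = \<sigma> (Suc k) \<cdot>\<^sub>m (P (Suc k) * (transpose_mat (Q (Suc k)) * Q i))"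
    using Pk Qk Qi by (subst mult_smult_assoc_mat[of _ m n _ "c i"]) auto
  also have "\<dots> = (if i = Suc k then \<sigma> i \<cdot>\<^sub>m P i else 0\<^sub>m m (c i))"
    using Pk Qki Pi by auto
  finally have "block_sum m n \<sigma> P Q (Suc k) * Q i
      = (if i \<le> k then \<sigma> i \<cdot>\<^sub>m P i else 0\<^sub>m m (c i))
        + (if i = Suc k then \<sigma> i \<cdot>\<^sub>m P i else 0\<^sub>m m (c i))"
    using Suc S Pk Qk Qi by (auto simp: add_mult_distrib_mat[of _ m n])
  then show ?case using Pi by auto
qed

text \<open>The shorter right factor decides the length of the product. This is why a full matrix
  and its truncation agree on anything produced by a truncated inverse.\<close>

lemma block_sum_mult:
  assumes P: "blocks m c s P" and Q: "orthonormal_blocks n c s Q" and R: "blocks l c s R"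
    and "k \<le> s"
  shows "block_sum m n \<sigma> P Q s * block_sum n l \<tau> Q R k
    = block_sum m l (\<lambda>i. \<sigma> i * \<tau> i) P R k"
  using assms(4)
proof (induction k)
  case 0
  then show ?case using block_sum_carrier[OF P orthonormal_blocksD[OF Q], of \<sigma>] by simp
next
  case (Suc k)
  note S = block_sum_carrier[OF P orthonormal_blocksD[OF Q], of \<sigma>]
  have T: "block_sum n l \<tau> Q R k \<in> carrier_mat n l"
    using Suc.prems Q R by (auto intro!: block_sum_carrier[where c = c] intro: blocks_mono orthonormal_blocksD)
  let ?k = "Suc k"
  have c: "P ?k \<in> carrier_mat m (c ?k)" "Q ?k \<in> carrier_mat n (c ?k)" "R ?k \<in> carrier_mat l (c ?k)"
    using Suc.prems P Q R unfolding orthonormal_blocks_def blocks_def by auto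
  have "block_sum m n \<sigma> P Q s * (\<tau> ?k \<cdot>\<^sub>m (Q ?k * transpose_mat (R ?k)))
      = \<tau> ?k \<cdot>\<^sub>m (block_sum m n \<sigma> P Q s * Q ?k * transpose_mat (R ?k))"
    using S c by (subst mult_smult_distrib[of _ m n _ l]) auto
  also have "block_sum m n \<sigma> P Q s * Q ?k = \<sigma> ?k \<cdot>\<^sub>m P ?k"
    using block_sum_mult_block[OF P Q, of s ?k \<sigma>] Suc.prems by simp
  also have "\<tau> ?k \<cdot>\<^sub>m (\<sigma> ?k \<cdot>\<^sub>m P ?k * transpose_mat (R ?k))
      = (\<sigma> ?k * \<tau> ?k) \<cdot>\<^sub>m (P ?k * transpose_mat (R ?k))"
    using c by (subst mult_smult_assoc_mat[of _ m "c ?k" _ l]) (auto intro!: eq_matI)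
  finally show ?case
    using Suc S T c by (auto simp: mult_add_distrib_mat[of _ m n])
qed

text \<open>Both products are block sums with the same family on either side, hence symmetric by
  \<open>transpose_block_sum\<close>. The other two Penrose equations reduce to identities between
  coefficients.\<close>

lemma is_moore_penrose_block_sum:
  assumes P: "orthonormal_blocks m c k P" and Q: "orthonormal_blocks n c k Q"
    and nz: "\<And>i. i \<in> {1..k} \<Longrightarrow> \<sigma> i \<noteq> 0"
  shows "is_moore_penrose (block_sum m n \<sigma> P Q k) (block_sum n m (\<lambda>i. 1 / \<sigma> i) Q P k)"
proof -
  note P' = orthonormal_blocksD[OF P] and Q' = orthonormal_blocksD[OF Q]
  let ?A = "block_sum m n \<sigma> P Q k" and ?X = "block_sum n m (\<lambda>i. 1 / \<sigma> i) Q P k"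
  have AX: "?A * ?X = block_sum m m (\<lambda>i. \<sigma> i * (1 / \<sigma> i)) P P k"
    by (rule block_sum_mult[OF P' Q P' order.refl])
  have XA: "?X * ?A = block_sum n n (\<lambda>i. 1 / \<sigma> i * \<sigma> i) Q Q k"
    by (rule block_sum_mult[OF Q' P Q' order.refl])
  have "?A * ?X * ?A = block_sum m n (\<lambda>i. \<sigma> i * (1 / \<sigma> i) * \<sigma> i) P Q k"
    unfolding AX by (rule block_sum_mult[OF P' P Q' order.refl])
  also have "\<dots> = ?A" using nz by (intro block_sum_cong) simp
  finally have 1: "?A * ?X * ?A = ?A" .
  have "?X * ?A * ?X = block_sum n m (\<lambda>i. 1 / \<sigma> i * \<sigma> i * (1 / \<sigma> i)) Q P k"
    unfolding XA by (rule block_sum_mult[OF Q' Q P' order.refl])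
  also have "\<dots> = ?X" using nz by (intro block_sum_cong) simp
  finally have 2: "?X * ?A * ?X = ?X" .
  show ?thesis
    unfolding is_moore_penrose_def
    using block_sum_carrier[OF P' Q', of \<sigma>] block_sum_carrier[OF Q' P', of "\<lambda>i. 1 / \<sigma> i"] 1 2
    by (auto simp: AX XA transpose_block_sum[OF P' P'] transpose_block_sum[OF Q' Q'])
qed

text \<open>The comparison is made at one vector \<open>b\<close> only, and the widths
  \<open>c\<close> and \<open>d\<close> are independent: this is what allows wide blocks to be
  exchanged for single columns.\<close>

lemma block_sum_mult_vec_cong:
  assumes "blocks m c k P" "blocks n c k Q" "blocks m d k P'" "blocks n d k Q'"
    and "b \<in> carrier_vec n"
    and "\<And>i. i \<in> {1..k} \<Longrightarrow>
      P i *\<^sub>v (transpose_mat (Q i) *\<^sub>v b) = P' i *\<^sub>v (transpose_mat (Q' i) *\<^sub>v b)"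
  shows "block_sum m n \<sigma> P Q k *\<^sub>v b = block_sum m n \<sigma> P' Q' k *\<^sub>v b"
  using assms
proof (induction k)
  case (Suc k)
  have smult_vec: "(a \<cdot>\<^sub>m M) *\<^sub>v b = a \<cdot>\<^sub>v (M *\<^sub>v b)" if "M \<in> carrier_mat m n" for a and M :: "real mat"
    using that \<open>b \<in> carrier_vec n\<close> by (intro eq_vecI) auto
  note P = blocks_SucD[OF Suc.prems(1)] and Q = blocks_SucD[OF Suc.prems(2)]
    and P' = blocks_SucD[OF Suc.prems(3)] and Q' = blocks_SucD[OF Suc.prems(4)]
  have "block_sum m n \<sigma> P Q k *\<^sub>v b = block_sum m n \<sigma> P' Q' k *\<^sub>v b"
    by (rule Suc.IH) (use P Q P' Q' Suc.prems in auto)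
  moreover have "P (Suc k) * transpose_mat (Q (Suc k)) *\<^sub>v b
      = P' (Suc k) * transpose_mat (Q' (Suc k)) *\<^sub>v b"
    using Suc.prems(6)[of "Suc k"] Suc.prems(5) P Q P' Q'
    by (subst (1 2) assoc_mult_mat_vec) auto
  moreover have "block_sum m n \<sigma> P Q (Suc k) *\<^sub>v b = block_sum m n \<sigma> P Q k *\<^sub>v b
      + \<sigma> (Suc k) \<cdot>\<^sub>v (P (Suc k) * transpose_mat (Q (Suc k)) *\<^sub>v b)"
    using P Q Suc.prems(5) block_sum_carrier[OF P(1) Q(1), of \<sigma>]
    by (auto simp: add_mult_distrib_mat_vec[of _ m n] smult_vec simp del: assoc_mult_mat_vec)
  moreover have "block_sum m n \<sigma> P' Q' (Suc k) *\<^sub>v b = block_sum m n \<sigma> P' Q' k *\<^sub>v b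
      + \<sigma> (Suc k) \<cdot>\<^sub>v (P' (Suc k) * transpose_mat (Q' (Suc k)) *\<^sub>v b)"
    using P' Q' Suc.prems(5) block_sum_carrier[OF P'(1) Q'(1), of \<sigma>]
    by (auto simp: add_mult_distrib_mat_vec[of _ m n] smult_vec simp del: assoc_mult_mat_vec)
  ultimately show ?case by simp
qed simp

section \<open>Block matrices as sums of blocks\<close>

text \<open>Two matrices side by side are encoded as a 2 by 2 block matrix whose lower blocks have
  no rows, so that block multiplication applies.\<close>

lemma mat_of_cols_append:
  "mat_of_cols m (xs @ ys) =
    four_block_mat (mat_of_cols m xs) (mat_of_cols m ys) (0\<^sub>m 0 (length xs)) (0\<^sub>m 0 (length ys))"
  by (intro eq_matI) (auto simp: mat_of_cols_index nth_append)

lemma four_block_mat_trivial: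
  assumes "X \<in> carrier_mat m n" "D \<in> carrier_mat 0 0"
  shows "four_block_mat X B C D = X"
  using assms by (intro eq_matI) auto

text \<open>The common step of all product formulas below. The diagonal blocks may be rectangular or
  empty, which also covers the zero rows below the singular values.\<close>

lemma mult_two_blocks:
  fixes P1 :: "real mat"
  assumes P: "P1 \<in> carrier_mat m p1" "P2 \<in> carrier_mat m p2"
    and Q: "Q1 \<in> carrier_mat n q1" "Q2 \<in> carrier_mat n q2"
    and D: "D1 \<in> carrier_mat p1 q1" "D2 \<in> carrier_mat p2 q2"
  shows "four_block_mat P1 P2 (0\<^sub>m 0 p1) (0\<^sub>m 0 p2)
      * four_block_mat D1 (0\<^sub>m p1 q2) (0\<^sub>m p2 q1) D2
      * transpose_mat (four_block_mat Q1 Q2 (0\<^sub>m 0 q1) (0\<^sub>m 0 q2))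
    = P1 * D1 * transpose_mat Q1 + P2 * D2 * transpose_mat Q2"
proof -
  have PD: "P1 * D1 \<in> carrier_mat m q1" "P2 * D2 \<in> carrier_mat m q2" using P D by simp_all
  have QT: "transpose_mat Q1 \<in> carrier_mat q1 n" "transpose_mat Q2 \<in> carrier_mat q2 n"
    using Q by simp_all
  have "four_block_mat P1 P2 (0\<^sub>m 0 p1) (0\<^sub>m 0 p2)
      * four_block_mat D1 (0\<^sub>m p1 q2) (0\<^sub>m p2 q1) D2
    = four_block_mat (P1 * D1) (P2 * D2) (0\<^sub>m 0 q1) (0\<^sub>m 0 q2)"
    using P D by (subst mult_four_block_mat[of _ m p1 _ p2 _ 0 _ _ q1 _ q2]) auto
  moreover have "transpose_mat (four_block_mat Q1 Q2 (0\<^sub>m 0 q1) (0\<^sub>m 0 q2))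
    = four_block_mat (transpose_mat Q1) (0\<^sub>m q1 0) (transpose_mat Q2) (0\<^sub>m q2 0)"
    using Q by (subst transpose_four_block_mat[of _ n q1 _ q2 _ 0]) auto
  ultimately show ?thesis
    using mult_four_block_mat[OF PD, of "0\<^sub>m 0 q1" 0 "0\<^sub>m 0 q2" "transpose_mat Q1" n
        "0\<^sub>m q1 0" 0 "transpose_mat Q2" "0\<^sub>m q2 0"] QT PD
      four_block_mat_trivial[of "P1 * D1 * transpose_mat Q1 + P2 * D2 * transpose_mat Q2" m n]
    by simp
qed

lemma hcat_snoc:
  assumes "M \<in> carrier_mat m l" "hcat m Ms \<in> carrier_mat m k"
  shows "hcat m (Ms @ [M]) = four_block_mat (hcat m Ms) M (0\<^sub>m 0 k) (0\<^sub>m 0 l)"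
proof -
  have "mat_of_cols m (cols M) = M" using assms(1) mat_of_cols_cols[of M] by simp
  moreover have "length (concat (map cols Ms)) = k"
    using carrier_matD(2)[OF assms(2)] unfolding hcat_def by (simp del: length_concat)
  ultimately show ?thesis
    using assms(1) unfolding hcat_def by (simp add: mat_of_cols_append del: length_concat)
qed

lemma hcat_blocks_carrier:
  assumes "blocks m c k P"
  shows "hcat m (map P [1..<Suc k]) \<in> carrier_mat m (\<Sum>i=1..k. c i)"
  using assms
proof (induction k)
  case 0
  show ?case using mat_of_cols_carrier(1)[of m "[]"] by (simp add: hcat_def)
next
  case (Suc k)
  note P = blocks_SucD[OF Suc.prems]
  have "hcat m (map P [1..<Suc (Suc k)]) = hcat m (map P [1..<Suc k] @ [P (Suc k)])" by simp
  also have "\<dots> \<in> carrier_mat m (\<Sum>i=1..Suc k. c i)"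
    unfolding hcat_snoc[OF P(2) Suc.IH[OF P(1)]]
    using carrier_matD[OF Suc.IH[OF P(1)]] carrier_matD[OF P(2)]
    by (intro carrier_matI) (simp_all del: upt_Suc)
  finally show ?case .
qed

lemma hcat_blocks_Suc:
  assumes "blocks m c (Suc k) P"
  shows "hcat m (map P [1..<Suc (Suc k)]) =
    four_block_mat (hcat m (map P [1..<Suc k])) (P (Suc k))
      (0\<^sub>m 0 (\<Sum>i=1..k. c i)) (0\<^sub>m 0 (c (Suc k)))"
  using hcat_snoc[OF blocks_SucD(2)[OF assms] hcat_blocks_carrier[OF blocks_SucD(1)[OF assms]]]
  by simp

lemma scalar_blocks_carrier:
  "scalar_blocks c \<sigma> k \<in> carrier_mat (\<Sum>i=1..k. c i) (\<Sum>i=1..k. c i)"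
  unfolding scalar_blocks_def carrier_mat_def
  by (auto simp: dim_diag_block_mat comp_def interv_sum_list_conv_sum_set_nat
      atLeastLessThanSuc_atLeastAtMost simp del: upt_Suc)

lemma scalar_blocks_Suc:
  "scalar_blocks c \<sigma> (Suc k) =
    four_block_mat (scalar_blocks c \<sigma> k) (0\<^sub>m (\<Sum>i=1..k. c i) (c (Suc k)))
      (0\<^sub>m (c (Suc k)) (\<Sum>i=1..k. c i)) (\<sigma> (Suc k) \<cdot>\<^sub>m 1\<^sub>m (c (Suc k)))"
  using scalar_blocks_carrier[of c \<sigma> k] unfolding scalar_blocks_def
  by (simp add: diag_block_mat_last Let_def)

text \<open>Appending one block to both outer factors and to the diagonal adds one summand, as in
  the recursion of \<open>block_sum\<close>. With no blocks, the product through dimension 0 is the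
  zero matrix.\<close>

lemma hcat_scalar_blocks:
  assumes "blocks m c k P" "blocks n c k Q"
  shows "hcat m (map P [1..<Suc k]) * scalar_blocks c \<sigma> k
      * transpose_mat (hcat n (map Q [1..<Suc k])) = block_sum m n \<sigma> P Q k"
  using assms
proof (induction k)
  case 0
  then show ?case by (auto simp: hcat_def scalar_blocks_def intro!: eq_matI)
next
  case (Suc k)
  note P = blocks_SucD[OF Suc.prems(1)] and Q = blocks_SucD[OF Suc.prems(2)]
  have "P (Suc k) * (\<sigma> (Suc k) \<cdot>\<^sub>m 1\<^sub>m (c (Suc k))) * transpose_mat (Q (Suc k))
      = \<sigma> (Suc k) \<cdot>\<^sub>m (P (Suc k) * transpose_mat (Q (Suc k)))"
    using P(2) Q(2)
    by (simp add: mult_smult_distrib[of _ m "c (Suc k)" _ "c (Suc k)"]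
        mult_smult_assoc_mat[of _ m "c (Suc k)" _ n])
  then show ?case
    using mult_two_blocks[OF hcat_blocks_carrier[OF P(1)] P(2) hcat_blocks_carrier[OF Q(1)] Q(2)
        scalar_blocks_carrier, of "\<sigma> (Suc k) \<cdot>\<^sub>m 1\<^sub>m (c (Suc k))" \<sigma>] Suc.IH[OF P(1) Q(1)]
    unfolding hcat_blocks_Suc[OF Suc.prems(1)] hcat_blocks_Suc[OF Suc.prems(2)] scalar_blocks_Suc
    by simp
qed

text \<open>The counterpart of \<open>hcat_scalar_blocks\<close> for blocks of width 1. Entries of
  \<open>mat_diag\<close> count from 0 and singular values from 1, hence
  \<open>Suc j\<close>.\<close>

lemma mat_of_cols_diag:
  "mat_of_cols m (map u [1..<Suc k]) * mat_diag k (\<lambda>j. \<sigma> (Suc j))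
      * transpose_mat (mat_of_cols n (map v [1..<Suc k]))
    = block_sum m n \<sigma> (\<lambda>i. mat_of_cols m [u i]) (\<lambda>i. mat_of_cols n [v i]) k"
proof (induction k)
  case 0
  then show ?case by (auto simp: mat_diag_def scalar_prod_def intro!: eq_matI)
next
  case (Suc k)
  have upt: "[1..<Suc (Suc k)] = [1..<Suc k] @ [Suc k]" by simp
  have c: "mat_of_cols l (map w [1..<Suc k]) \<in> carrier_mat l k"
    "mat_of_cols l [w (Suc k)] \<in> carrier_mat l 1"
    "mat_of_cols l (map w [1..<Suc (Suc k)]) = four_block_mat (mat_of_cols l (map w [1..<Suc k]))
      (mat_of_cols l [w (Suc k)]) (0\<^sub>m 0 k) (0\<^sub>m 0 1)" for l and w :: "nat \<Rightarrow> real vec"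
    using mat_of_cols_carrier(1)[of l "map w [1..<Suc k]"] mat_of_cols_carrier(1)[of l "[w (Suc k)]"]
      mat_of_cols_append[of l "map w [1..<Suc k]" "[w (Suc k)]"] upt
    by (simp_all del: upt_Suc)
  have d: "mat_diag (Suc k) (\<lambda>j. \<sigma> (Suc j)) = four_block_mat (mat_diag k (\<lambda>j. \<sigma> (Suc j)))
      (0\<^sub>m k 1) (0\<^sub>m 1 k) (\<sigma> (Suc k) \<cdot>\<^sub>m 1\<^sub>m 1)"
    by (intro eq_matI) (auto simp: mat_diag_def less_Suc_eq)
  have "mat_of_cols m [u (Suc k)] * (\<sigma> (Suc k) \<cdot>\<^sub>m 1\<^sub>m 1) * transpose_mat (mat_of_cols n [v (Suc k)])
      = \<sigma> (Suc k) \<cdot>\<^sub>m (mat_of_cols m [u (Suc k)] * transpose_mat (mat_of_cols n [v (Suc k)]))"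
    using c(2)[of m u] c(2)[of n v]
    by (simp add: mult_smult_distrib[of _ m 1 _ 1] mult_smult_assoc_mat[of _ m 1 _ n])
  then show ?case
    using mult_two_blocks[OF c(1,2)[of m u] c(1,2)[of n v], of "mat_diag k (\<lambda>j. \<sigma> (Suc j))"
        "\<sigma> (Suc k) \<cdot>\<^sub>m 1\<^sub>m 1"] Suc.IH
    unfolding c(3) d by simp
qed

text \<open>The offset is the total width of the blocks before the \<open>i\<close>-th. The bound is
  carried along because the induction step needs it to see that the column lies in the old
  part.\<close>

lemma col_hcat_blocks:
  assumes "blocks m c k P" "i \<in> {1..k}" "a < c i"
  shows "(\<Sum>l=1..<i. c l) + a < (\<Sum>l=1..k. c l) \<and>
    col (hcat m (map P [1..<Suc k])) ((\<Sum>l=1..<i. c l) + a) = col (P i) a"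
  using assms
proof (induction k)
  case (Suc k)
  note P = blocks_SucD[OF Suc.prems(1)]
  note H = hcat_blocks_carrier[OF P(1)]
  show ?case
  proof (cases "i \<le> k")
    case True
    with Suc.IH[OF P(1)] Suc.prems have
      lt: "(\<Sum>l=1..<i. c l) + a < (\<Sum>l=1..k. c l)" and
      eq: "col (hcat m (map P [1..<Suc k])) ((\<Sum>l=1..<i. c l) + a) = col (P i) a"
      by auto
    have "col (hcat m (map P [1..<Suc (Suc k)])) ((\<Sum>l=1..<i. c l) + a)
        = col (hcat m (map P [1..<Suc k])) ((\<Sum>l=1..<i. c l) + a)"
      unfolding hcat_blocks_Suc[OF Suc.prems(1)]
      using lt H P(2) by (intro eq_vecI) (auto simp del: upt_Suc)
    with lt eq show ?thesis by simp
  next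
    case False
    with Suc.prems have i: "i = Suc k" by auto
    then have s: "(\<Sum>l=1..<i. c l) = (\<Sum>l=1..k. c l)"
      by (simp add: atLeastLessThanSuc_atLeastAtMost)
    have "col (hcat m (map P [1..<Suc (Suc k)])) ((\<Sum>l=1..k. c l) + a) = col (P (Suc k)) a"
      unfolding hcat_blocks_Suc[OF Suc.prems(1)]
      using H P(2) Suc.prems i by (intro eq_vecI) (auto simp del: upt_Suc)
    then show ?thesis using Suc.prems unfolding s by (simp add: i)
  qed
qed simp

text \<open>Each entry of \<open>transpose_mat (P i) * P j\<close> is an entry of the Gram matrix of
  the concatenation, shifted by the two block offsets. As different blocks occupy disjoint column
  ranges, it is diagonal exactly when both block and position agree.\<close>

lemma orthonormal_blocksI:
  assumes P: "blocks m c k P"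
    and orth: "transpose_mat (hcat m (map P [1..<Suc k])) * hcat m (map P [1..<Suc k])
      = 1\<^sub>m (\<Sum>i=1..k. c i)"
  shows "orthonormal_blocks m c k P"
  unfolding orthonormal_blocks_def
proof (intro conjI ballI P)
  fix i j assume i: "i \<in> {1..k}" and j: "j \<in> {1..k}"
  have Pi: "P i \<in> carrier_mat m (c i)" and Pj: "P j \<in> carrier_mat m (c j)"
    using P i j unfolding blocks_def by auto
  let ?H = "hcat m (map P [1..<Suc k])"
  let ?o = "\<lambda>i. \<Sum>l=1..<i. c l"
  note H = hcat_blocks_carrier[OF P]
  have off: "?o i + c i \<le> ?o j" if "i < j" "1 \<le> i" for i j
  proof -
    have "?o i + c i = ?o (Suc i)" using that by simp
    also have "\<dots> \<le> ?o j" using that by (intro sum_mono2) auto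
    finally show ?thesis .
  qed
  have inj: "(?o i + a = ?o j + b) = (i = j \<and> a = b)" if "a < c i" "b < c j" for a b
  proof (cases i j rule: linorder_cases)
    case less
    then show ?thesis using off[of i j] i that by auto
  next
    case greater
    then show ?thesis using off[of j i] j that by auto
  qed simp
  show "transpose_mat (P i) * P j = (if i = j then 1\<^sub>m (c i) else 0\<^sub>m (c i) (c j))" (is "?L = ?R")
  proof (rule eq_matI)
    fix a b assume "a < dim_row ?R" "b < dim_col ?R"
    then have a: "a < c i" and b: "b < c j" by (auto split: if_splits)
    note ca = col_hcat_blocks[OF P i a] and cb = col_hcat_blocks[OF P j b]
    have "?L $$ (a, b) = col (P i) a \<bullet> col (P j) b" using a b Pi Pj by simp
    also have "\<dots> = col ?H (?o i + a) \<bullet> col ?H (?o j + b)" using ca cb by simp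
    also have "\<dots> = (transpose_mat ?H * ?H) $$ (?o i + a, ?o j + b)" using ca cb H by simp
    also have "\<dots> = (if i = j \<and> a = b then 1 else 0)"
      unfolding orth using ca cb inj[OF a b] by simp
    also have "\<dots> = ?R $$ (a, b)" using a b by auto
    finally show "?L $$ (a, b) = ?R $$ (a, b)" .
  qed (use Pi Pj in auto)
qed

text \<open>Serves to discard \<open>Uhat_perp\<close> from the orthogonality of
  \<open>Uhat\<close>. The size \<open>d\<close> is forced to be \<open>h + l\<close> by comparing
  dimensions.\<close>

lemma gram_left_block:
  fixes H :: "real mat"
  assumes H: "H \<in> carrier_mat m h" and M: "M \<in> carrier_mat m l"
    and orth: "transpose_mat (four_block_mat H M (0\<^sub>m 0 h) (0\<^sub>m 0 l))
      * four_block_mat H M (0\<^sub>m 0 h) (0\<^sub>m 0 l) = 1\<^sub>m d"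
  shows "transpose_mat H * H = 1\<^sub>m h"
proof -
  let ?F = "four_block_mat H M (0\<^sub>m 0 h) (0\<^sub>m 0 l)"
  have d: "d = h + l" using arg_cong[OF orth, of dim_row] H M by simp
  have col: "col ?F a = col H a" if "a < h" for a
    using that H M by (intro eq_vecI) auto
  show ?thesis
  proof (rule eq_matI)
    fix a b assume "a < dim_row (1\<^sub>m h :: real mat)" "b < dim_col (1\<^sub>m h :: real mat)"
    then have ab: "a < h" "b < h" by simp_all
    have "(transpose_mat H * H) $$ (a, b) = col ?F a \<bullet> col ?F b"
      unfolding col[OF ab(1)] col[OF ab(2)] using ab H by simp
    also have "\<dots> = (transpose_mat ?F * ?F) $$ (a, b)" using ab H M by simp
    also have "\<dots> = (1\<^sub>m h :: real mat) $$ (a, b)" unfolding orth d using ab by simp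
    finally show "(transpose_mat H * H) $$ (a, b) = (1\<^sub>m h :: real mat) $$ (a, b)" .
  qed (use H in auto)
qed

section \<open>Passing from blocks to single columns\<close>

text \<open>In \<open>transpose_mat (W i) * (transpose_mat (P i) * P j) * W j\<close> the inner
  factor is an identity or zero. Taking for \<open>W i\<close> one unit column reduces each block to
  a single column.\<close>

lemma orthonormal_blocks_mult:
  assumes P: "orthonormal_blocks m c s P"
    and W: "\<And>i. i \<in> {1..s} \<Longrightarrow> W i \<in> carrier_mat (c i) (d i)"
      "\<And>i. i \<in> {1..s} \<Longrightarrow> transpose_mat (W i) * W i = 1\<^sub>m (d i)"
    and R: "\<And>i. i \<in> {1..s} \<Longrightarrow> R i = P i * W i"
  shows "orthonormal_blocks m d s R"
  unfolding orthonormal_blocks_def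
proof (intro conjI ballI)
  have Pc: "P i \<in> carrier_mat m (c i)" if "i \<in> {1..s}" for i
    using P that unfolding orthonormal_blocks_def blocks_def by blast
  show "blocks m d s R"
    unfolding blocks_def by (intro ballI) (simp only: R mult_carrier_mat[OF Pc W(1)])
  fix i j assume i: "i \<in> {1..s}" and j: "j \<in> {1..s}"
  note c = Pc[OF i] Pc[OF j] W(1)[OF i] W(1)[OF j]
  have PP: "transpose_mat (P i) * P j = (if i = j then 1\<^sub>m (c i) else 0\<^sub>m (c i) (c j))"
    using P i j unfolding orthonormal_blocks_def by blast
  have "transpose_mat (R i) * R j
      = transpose_mat (W i) * transpose_mat (P i) * (P j * W j)"
    unfolding R[OF i] R[OF j] transpose_mult[OF c(1,3)] ..
  also have "\<dots> = transpose_mat (W i) * (transpose_mat (P i) * (P j * W j))"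
    using c by (intro assoc_mult_mat) auto
  also have "transpose_mat (P i) * (P j * W j) = transpose_mat (P i) * P j * W j"
    using c by (intro assoc_mult_mat[symmetric]) auto
  also have "transpose_mat (W i) * (transpose_mat (P i) * P j * W j)
      = (if i = j then 1\<^sub>m (d i) else 0\<^sub>m (d i) (d j))"
    unfolding PP using c W(2)[OF j] by auto
  finally show "transpose_mat (R i) * R j = (if i = j then 1\<^sub>m (d i) else 0\<^sub>m (d i) (d j))" .
qed

lemma mat_of_cols_single_mult:
  assumes "M \<in> carrier_mat m l" "w \<in> carrier_vec l"
  shows "mat_of_cols m [M *\<^sub>v w] = M * mat_of_cols l [w]"
proof (rule eq_matI)
  fix i j assume "i < dim_row (M * mat_of_cols l [w])" "j < dim_col (M * mat_of_cols l [w])"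
  then show "mat_of_cols m [M *\<^sub>v w] $$ (i, j) = (M * mat_of_cols l [w]) $$ (i, j)"
    using assms by (simp add: mat_of_cols_index)
qed (use assms in auto)

lemma dyad_mult_vec:
  fixes b :: "real vec"
  assumes "u \<in> carrier_vec m" "v \<in> carrier_vec n" "b \<in> carrier_vec n"
  shows "mat_of_cols m [u] *\<^sub>v (transpose_mat (mat_of_cols n [v]) *\<^sub>v b) = (v \<bullet> b) \<cdot>\<^sub>v u"
proof (rule eq_vecI)
  fix i assume "i < dim_vec ((v \<bullet> b) \<cdot>\<^sub>v u)"
  then show "(mat_of_cols m [u] *\<^sub>v (transpose_mat (mat_of_cols n [v]) *\<^sub>v b)) $ i
      = ((v \<bullet> b) \<cdot>\<^sub>v u) $ i"
    using assms by (simp add: scalar_prod_def mat_of_cols_index)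
qed (use assms in auto)

text \<open>A vector is its own projection onto the line it spans. The second equation later
  recovers all of \<open>g\<close> from its component along one direction.\<close>

lemma normalized_scalar_prod:
  assumes g: "g \<in> carrier_vec l" "g \<noteq> 0\<^sub>v l"
  defines "w \<equiv> (1 / vnorm g) \<cdot>\<^sub>v g"
  shows "w \<bullet> w = 1" "(w \<bullet> g) \<cdot>\<^sub>v w = g"
proof -
  have nz: "vnorm g \<noteq> 0"
    using scalar_prod_self_eq_0[OF g(1)] g(2) vnorm_sq[of g] by force
  show "w \<bullet> w = 1" "(w \<bullet> g) \<cdot>\<^sub>v w = g"
    using nz g(1) vnorm_sq[of g, symmetric]
    by (auto simp: w_def smult_smult_assoc field_simps intro!: eq_vecI)
qed

section \<open>Agreement of the truncated least squares problems\<close>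

theorem theorem2p1:
  fixes m n s :: nat
    and c :: "nat \<Rightarrow> nat" and \<sigma> :: "nat \<Rightarrow> real"
    and A Uhat Uhat_perp Vhat U V A' :: "real mat"
    and Uh Vh Ak A'k :: "nat \<Rightarrow> real mat"
    and b x_naive :: "real vec"
    and u v x_tsvd :: "nat \<Rightarrow> real vec"
    and us vs :: "nat \<Rightarrow> real vec list"
  assumes mn: "n \<le> m" and s: "1 \<le> s"
    and c_pos: "\<And>i. i \<in> {1..s} \<Longrightarrow> 1 \<le> c i"
    and c_sum: "(\<Sum>i=1..s. c i) = n"
    and sigma_pos: "\<And>i. i \<in> {1..s} \<Longrightarrow> 0 < \<sigma> i"
    and sigma_decr: "\<And>i j. 1 \<le> i \<Longrightarrow> i < j \<Longrightarrow> j \<le> s \<Longrightarrow> \<sigma> j < \<sigma> i"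
    and Uh: "\<And>i. i \<in> {1..s} \<Longrightarrow> Uh i \<in> carrier_mat m (c i)"
    and Vh: "\<And>i. i \<in> {1..s} \<Longrightarrow> Vh i \<in> carrier_mat n (c i)"
    and Uhat_perp: "Uhat_perp \<in> carrier_mat m (m - n)"
    and Uhat: "Uhat = hcat m (map Uh [1..<Suc s] @ [Uhat_perp])"
    and Vhat: "Vhat = hcat n (map Vh [1..<Suc s])"
    and Uhat_orth: "orthonormal_square_mat Uhat"
    and Vhat_orth: "orthonormal_square_mat Vhat"
    and svd: "A = Uhat * (scalar_blocks c \<sigma> s @\<^sub>r 0\<^sub>m (m - n) n) * transpose_mat Vhat"
    and b: "b \<in> carrier_vec m"
    and b_nz: "\<And>i. i \<in> {1..s} \<Longrightarrow> transpose_mat (Uh i) *\<^sub>v b \<noteq> 0\<^sub>v (c i)"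
    and x_naive: "x_naive = pinv A *\<^sub>v b"
    and Ak: "\<And>k. k \<in> {1..s} \<Longrightarrow>
        Ak k = hcat m (map Uh [1..<Suc k]) * scalar_blocks c \<sigma> k
                * transpose_mat (hcat n (map Vh [1..<Suc k]))"
    and u: "\<And>i. i \<in> {1..s} \<Longrightarrow>
        u i = (1 / vnorm (transpose_mat (Uh i) *\<^sub>v b)) \<cdot>\<^sub>v (Uh i *\<^sub>v (transpose_mat (Uh i) *\<^sub>v b))"
    and v: "\<And>i. i \<in> {1..s} \<Longrightarrow> v i = (1 / \<sigma> i) \<cdot>\<^sub>v (transpose_mat A *\<^sub>v u i)"
    and us_len: "\<And>i. i \<in> {1..s} \<Longrightarrow> length (us i) = c i - 1"
    and us_basis: "\<And>i. i \<in> {1..s} \<Longrightarrow> orthonormal_basis_of_col_space m (u i # us i) (Uh i)"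
    and vs: "\<And>i. i \<in> {1..s} \<Longrightarrow> vs i = map (\<lambda>w. (1 / \<sigma> i) \<cdot>\<^sub>v (transpose_mat A *\<^sub>v w)) (us i)"
    and U: "U = mat_of_cols m (map u [1..<Suc s] @ concat (map us [1..<Suc s]))"
    and V: "V = mat_of_cols n (map v [1..<Suc s] @ concat (map vs [1..<Suc s]))"
    and A': "A' = U * mat_diag n (\<lambda>j. if j < s then \<sigma> (Suc j) else 0) * transpose_mat V"
    and A'k: "\<And>k. k \<in> {1..s} \<Longrightarrow>
        A'k k = mat_of_cols m (map u [1..<Suc k]) * mat_diag k (\<lambda>j. \<sigma> (Suc j))
                 * transpose_mat (mat_of_cols n (map v [1..<Suc k]))"
    and x_tsvd: "\<And>k. k \<in> {1..s} \<Longrightarrow> x_tsvd k = min_norm_lsq_sol (Ak k) b"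
  shows
    "(\<forall>k \<in> {1..s}.
        (\<exists>!x. min_norm_lsq (Ak k) b x) \<and>
        x_tsvd k = pinv (Ak k) *\<^sub>v b \<and>
        pinv (Ak k) *\<^sub>v b = pinv (A'k k) *\<^sub>v b \<and>
        vnorm (A *\<^sub>v x_tsvd k - b) = vnorm (Ak k *\<^sub>v x_tsvd k - b) \<and>
        vnorm (Ak k *\<^sub>v x_tsvd k - b) = vnorm (A'k k *\<^sub>v x_tsvd k - b) \<and>
        vnorm (A'k k *\<^sub>v x_tsvd k - b) = vnorm (A' *\<^sub>v x_tsvd k - b)) \<and>
     (x_naive = x_tsvd s \<and> x_tsvd s = pinv A *\<^sub>v b \<and> pinv A *\<^sub>v b = pinv A' *\<^sub>v b) \<and>
     (\<forall>k \<in> {1..s}.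
        (\<exists>!x. min_norm_lsq (A'k k) b x) \<and>
        min_norm_lsq_sol (Ak k) b = min_norm_lsq_sol (A'k k) b \<and>
        vnorm (Ak k *\<^sub>v min_norm_lsq_sol (Ak k) b - b)
          = vnorm (A'k k *\<^sub>v min_norm_lsq_sol (A'k k) b - b))"
proof -
  let ?N = "\<lambda>k. \<Sum>i=1..k. c i"
  have Ub: "blocks m c s Uh" and Vb: "blocks n c s Vh"
    using Uh Vh unfolding blocks_def by auto
  have Hc: "hcat m (map Uh [1..<Suc s]) \<in> carrier_mat m n"
    and HVc: "hcat n (map Vh [1..<Suc s]) \<in> carrier_mat n n"
    using hcat_blocks_carrier[OF Ub] hcat_blocks_carrier[OF Vb] unfolding c_sum by simp_all
  have Dc: "scalar_blocks c \<sigma> s \<in> carrier_mat n n"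
    using scalar_blocks_carrier[of c \<sigma> s] unfolding c_sum .
  have Uhat': "Uhat = four_block_mat (hcat m (map Uh [1..<Suc s])) Uhat_perp (0\<^sub>m 0 n) (0\<^sub>m 0 (m - n))"
    unfolding Uhat by (rule hcat_snoc[OF Uhat_perp Hc])
  \<comment> \<open>There is no complement on the right side, so a second block without columns is
    added to match the two-block shape of \<open>Uhat\<close>.\<close>
  have Vhat': "Vhat = four_block_mat (hcat n (map Vh [1..<Suc s])) (0\<^sub>m n 0) (0\<^sub>m 0 n) (0\<^sub>m 0 0)"
    unfolding Vhat using HVc by (intro eq_matI) auto
  have Uo: "orthonormal_blocks m c s Uh"
  proof (rule orthonormal_blocksI[OF Ub])
    show "transpose_mat (hcat m (map Uh [1..<Suc s])) * hcat m (map Uh [1..<Suc s]) = 1\<^sub>m (?N s)"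
      unfolding c_sum using Uhat_orth unfolding orthonormal_square_mat_def Uhat'
      by (intro gram_left_block[OF Hc Uhat_perp]) blast
  qed
  have Vo: "orthonormal_blocks n c s Vh"
  proof (rule orthonormal_blocksI[OF Vb])
    show "transpose_mat (hcat n (map Vh [1..<Suc s])) * hcat n (map Vh [1..<Suc s]) = 1\<^sub>m (?N s)"
      unfolding c_sum using Vhat_orth HVc unfolding orthonormal_square_mat_def Vhat by simp
  qed
  have nz: "\<sigma> i \<noteq> 0" if "i \<in> {1..s}" for i using sigma_pos[OF that] by simp

  have Ak': "Ak k = block_sum m n \<sigma> Uh Vh k" if k: "k \<in> {1..s}" for k
    unfolding Ak[OF k] using k Ub Vb by (intro hcat_scalar_blocks) (auto intro: blocks_mono)
  have A_eq: "A = block_sum m n \<sigma> Uh Vh s"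
  proof -
    \<comment> \<open>The appended zero rows are read as a zero block beneath the singular values
      next to an empty column block. The diagonal block facing \<open>Uhat_perp\<close> then has no
      columns, and its contribution is zero.\<close>
    have "scalar_blocks c \<sigma> s @\<^sub>r 0\<^sub>m (m - n) n
        = four_block_mat (scalar_blocks c \<sigma> s) (0\<^sub>m n 0) (0\<^sub>m (m - n) n) (0\<^sub>m (m - n) 0)"
      using Dc unfolding append_rows_def by simp
    then have "A = hcat m (map Uh [1..<Suc s]) * scalar_blocks c \<sigma> s
          * transpose_mat (hcat n (map Vh [1..<Suc s]))
        + Uhat_perp * 0\<^sub>m (m - n) 0 * transpose_mat (0\<^sub>m n 0)"
      unfolding svd Uhat' Vhat'
      using mult_two_blocks[OF Hc Uhat_perp HVc _ Dc, of "0\<^sub>m n 0" 0 "0\<^sub>m (m - n) 0"] by simp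
    also have "\<dots> = block_sum m n \<sigma> Uh Vh s"
      unfolding hcat_scalar_blocks[OF Ub Vb]
      using Uhat_perp block_sum_carrier[OF Ub Vb, of \<sigma>] by auto
    finally show ?thesis .
  qed
  have At: "transpose_mat A = block_sum n m \<sigma> Vh Uh s"
    unfolding A_eq by (rule transpose_block_sum[OF Ub Vb])

  \<comment> \<open>\<open>g i\<close> holds the coordinates, in the \<open>i\<close>-th left block,
    of the projection of \<open>b\<close>. By \<open>b_nz\<close> it can be normalized, which gives
    \<open>w i\<close>.\<close>
  define g where "g i = transpose_mat (Uh i) *\<^sub>v b" for i
  define w where "w i = (1 / vnorm (g i)) \<cdot>\<^sub>v g i" for i
  have g: "g i \<in> carrier_vec (c i)" "g i \<noteq> 0\<^sub>v (c i)" if "i \<in> {1..s}" for i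
    using Uh[OF that] b b_nz[OF that] unfolding g_def by auto
  have wc: "w i \<in> carrier_vec (c i)" if "i \<in> {1..s}" for i
    using g(1)[OF that] unfolding w_def by simp
  have ww: "w i \<bullet> w i = 1" and wg: "(w i \<bullet> g i) \<cdot>\<^sub>v w i = g i" if "i \<in> {1..s}" for i
    unfolding w_def by (rule normalized_scalar_prod[OF g[OF that]])+
  have uw: "u i = Uh i *\<^sub>v w i" if i: "i \<in> {1..s}" for i
    unfolding u[OF i] w_def g_def[symmetric] using mult_mat_vec[OF Uh[OF i] g(1)[OF i]] by simp
  \<comment> \<open>The transpose of \<open>A\<close> sends \<open>Uh i\<close> to
    \<open>\<sigma> i \<cdot>\<^sub>m Vh i\<close>; the factor \<open>1 / \<sigma> i\<close> in
    \<open>v\<close> cancels, and the coordinates stay the same.\<close>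
  have vw: "v i = Vh i *\<^sub>v w i" if i: "i \<in> {1..s}" for i
  proof -
    have "transpose_mat A *\<^sub>v u i = (transpose_mat A * Uh i) *\<^sub>v w i"
      unfolding uw[OF i] At
      using block_sum_carrier[OF Vb Ub] Uh[OF i] wc[OF i]
      by (intro assoc_mult_mat_vec[symmetric])
    also have "transpose_mat A * Uh i = \<sigma> i \<cdot>\<^sub>m Vh i"
      unfolding At using block_sum_mult_block[OF Vb Uo order.refl i] i by simp
    finally have "transpose_mat A *\<^sub>v u i = (\<sigma> i \<cdot>\<^sub>m Vh i) *\<^sub>v w i" .
    then show ?thesis
      unfolding v[OF i] using nz[OF i] Vh[OF i] wc[OF i] by (intro eq_vecI) auto
  qed
  have uc: "u i \<in> carrier_vec m" and vc: "v i \<in> carrier_vec n" if i: "i \<in> {1..s}" for i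
    unfolding uw[OF i] vw[OF i] using Uh[OF i] Vh[OF i] wc[OF i] by auto
  define u1 where "u1 i = mat_of_cols m [u i]" for i
  define v1 where "v1 i = mat_of_cols n [v i]" for i
  have W: "mat_of_cols (c i) [w i] \<in> carrier_mat (c i) 1"
    "transpose_mat (mat_of_cols (c i) [w i]) * mat_of_cols (c i) [w i] = 1\<^sub>m 1"
    if "i \<in> {1..s}" for i
    using ww[OF that] wc[OF that] mat_of_cols_carrier(1)[of "c i" "[w i]"] by (auto intro!: eq_matI)
  have uo: "orthonormal_blocks m (\<lambda>_. 1) s u1"
    using mat_of_cols_single_mult[OF Uh wc]
    by (intro orthonormal_blocks_mult[OF Uo W]) (auto simp: u1_def uw)
  have vo: "orthonormal_blocks n (\<lambda>_. 1) s v1"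
    using mat_of_cols_single_mult[OF Vh wc]
    by (intro orthonormal_blocks_mult[OF Vo W]) (auto simp: v1_def vw)
  note ub = orthonormal_blocksD[OF uo] and vb = orthonormal_blocksD[OF vo]

  have A'k': "A'k k = block_sum m n \<sigma> u1 v1 k" if k: "k \<in> {1..s}" for k
    unfolding A'k[OF k] u1_def v1_def by (rule mat_of_cols_diag)
  have A'_eq: "A' = block_sum m n \<sigma> u1 v1 s"
  proof -
    have sn: "s \<le> n"
      using sum_mono[of "{1..s}" "\<lambda>_. 1" c] c_pos c_sum by simp
    have "sum_list (map (length \<circ> us) [1..<Suc s]) = (\<Sum>i=1..s. c i - 1)"
      using us_len by (simp add: interv_sum_list_conv_sum_set_nat atLeastLessThanSuc_atLeastAtMost
          comp_def del: upt_Suc)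
    \<comment> \<open>Subtraction is on naturals; \<open>c_pos\<close> ensures that no term is cut
      off at 0.\<close>
    also have "\<dots> = n - s"
      using sum_subtractf_nat[of "{1..s}" "\<lambda>_. 1" c] c_pos c_sum by simp
    finally have us: "length (concat (map us [1..<Suc s])) = n - s"
      by (simp add: length_concat comp_def del: upt_Suc)
    have "map length (map vs [1..<Suc s]) = map length (map us [1..<Suc s])"
      using vs by (auto simp del: upt_Suc)
    then have vs': "length (concat (map vs [1..<Suc s])) = n - s"
      using us unfolding length_concat by (simp only:)
    let ?u = "map u [1..<Suc s]" and ?us = "concat (map us [1..<Suc s])"
    let ?v = "map v [1..<Suc s]" and ?vs = "concat (map vs [1..<Suc s])"
    let ?d = "\<lambda>j. if j < s then \<sigma> (Suc j) else 0"
    have c: "mat_of_cols m ?u \<in> carrier_mat m s" "mat_of_cols m ?us \<in> carrier_mat m (n - s)"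
      "mat_of_cols n ?v \<in> carrier_mat n s" "mat_of_cols n ?vs \<in> carrier_mat n (n - s)"
      using us vs' unfolding carrier_mat_def by (simp_all del: length_concat upt_Suc)
    \<comment> \<open>Splitting after position \<open>s\<close> places all additional columns
      opposite the zero part of the diagonal.\<close>
    have d: "mat_diag n ?d = four_block_mat (mat_diag s (\<lambda>j. \<sigma> (Suc j)))
        (0\<^sub>m s (n - s)) (0\<^sub>m (n - s) s) (0\<^sub>m (n - s) (n - s))"
      using sn by (intro eq_matI) (auto simp: mat_diag_def)
    have UV: "U = four_block_mat (mat_of_cols m ?u) (mat_of_cols m ?us) (0\<^sub>m 0 s) (0\<^sub>m 0 (n - s))"
      "V = four_block_mat (mat_of_cols n ?v) (mat_of_cols n ?vs) (0\<^sub>m 0 s) (0\<^sub>m 0 (n - s))"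
      unfolding U V mat_of_cols_append us vs' by (simp_all del: upt_Suc)
    have "A' = mat_of_cols m ?u * mat_diag s (\<lambda>j. \<sigma> (Suc j)) * transpose_mat (mat_of_cols n ?v)
        + mat_of_cols m ?us * 0\<^sub>m (n - s) (n - s) * transpose_mat (mat_of_cols n ?vs)"
      unfolding A' d UV by (rule mult_two_blocks[OF c]) simp_all
    also have "mat_of_cols m ?us * 0\<^sub>m (n - s) (n - s) * transpose_mat (mat_of_cols n ?vs) = 0\<^sub>m m n"
      unfolding right_mult_zero_mat[OF c(2)]
      by (rule left_mult_zero_mat) (use c(4) in \<open>simp only: transpose_carrier_mat\<close>)
    also have "mat_of_cols m ?u * mat_diag s (\<lambda>j. \<sigma> (Suc j)) * transpose_mat (mat_of_cols n ?v)
        = block_sum m n \<sigma> u1 v1 s"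
      unfolding u1_def v1_def by (rule mat_of_cols_diag)
    finally show ?thesis using block_sum_carrier[OF ub vb, of \<sigma>] by simp
  qed

  have ub_eq: "u i \<bullet> b = w i \<bullet> g i" if i: "i \<in> {1..s}" for i
  proof -
    have "u i \<bullet> b = b \<bullet> (Uh i *\<^sub>v w i)" using uc[OF i] b uw[OF i] by (simp add: comm_scalar_prod)
    also have "\<dots> = g i \<bullet> w i"
      unfolding g_def by (rule transpose_vec_mult_scalar[OF Uh[OF i] wc[OF i] b, symmetric])
    finally show ?thesis using g(1)[OF i] wc[OF i] by (simp add: comm_scalar_prod)
  qed
  \<comment> \<open>By \<open>dyad_mult_vec\<close> and \<open>ub_eq\<close> the right sides are
    \<open>w i \<bullet> g i\<close> times \<open>u i\<close> and \<open>v i\<close>. Since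
    \<open>(w i \<bullet> g i) \<cdot>\<^sub>v w i = g i\<close>, the single direction already
    carries the whole block component of \<open>b\<close>. The first equation serves the projections
    of \<open>b\<close>, the second the inverses.\<close>
  have termU: "Uh i *\<^sub>v (transpose_mat (Uh i) *\<^sub>v b) = u1 i *\<^sub>v (transpose_mat (u1 i) *\<^sub>v b)"
    and termV: "Vh i *\<^sub>v (transpose_mat (Uh i) *\<^sub>v b) = v1 i *\<^sub>v (transpose_mat (u1 i) *\<^sub>v b)"
    if i: "i \<in> {1..s}" for i
    unfolding u1_def v1_def dyad_mult_vec[OF uc[OF i] uc[OF i] b] dyad_mult_vec[OF vc[OF i] uc[OF i] b]
      ub_eq[OF i] g_def[symmetric]
    using mult_mat_vec[OF Uh[OF i] wc[OF i], of "w i \<bullet> g i"]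
      mult_mat_vec[OF Vh[OF i] wc[OF i], of "w i \<bullet> g i"]
    by (simp_all add: uw[OF i] vw[OF i] wg[OF i])

  define X where "X k = block_sum n m (\<lambda>i. 1 / \<sigma> i) Vh Uh k" for k
  define X' where "X' k = block_sum n m (\<lambda>i. 1 / \<sigma> i) v1 u1 k" for k
  have mp: "is_moore_penrose (Ak k) (X k)" and mp': "is_moore_penrose (A'k k) (X' k)"
    if k: "k \<in> {1..s}" for k
    unfolding Ak'[OF k] A'k'[OF k] X_def X'_def
    using k nz by (auto intro!: is_moore_penrose_block_sum
        intro: orthonormal_blocks_mono[OF Uo] orthonormal_blocks_mono[OF Vo]
          orthonormal_blocks_mono[OF uo] orthonormal_blocks_mono[OF vo])
  have Akc: "Ak k \<in> carrier_mat m n" and A'kc: "A'k k \<in> carrier_mat m n"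
    and Xc: "X k \<in> carrier_mat n m" and X'c: "X' k \<in> carrier_mat n m"
    if k: "k \<in> {1..s}" for k
  proof -
    have ks: "k \<le> s" using k by simp
    note bm = blocks_mono[OF Ub ks] blocks_mono[OF Vb ks] blocks_mono[OF ub ks] blocks_mono[OF vb ks]
    show "Ak k \<in> carrier_mat m n" "A'k k \<in> carrier_mat m n"
      "X k \<in> carrier_mat n m" "X' k \<in> carrier_mat n m"
      unfolding Ak'[OF k] A'k'[OF k] X_def X'_def
      by (rule block_sum_carrier[OF bm(1,2)] block_sum_carrier[OF bm(3,4)]
          block_sum_carrier[OF bm(2,1)] block_sum_carrier[OF bm(4,3)])+
  qed
  have XX': "X k *\<^sub>v b = X' k *\<^sub>v b" if k: "k \<in> {1..s}" for k
  proof -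
    have ks: "k \<le> s" using k by simp
    show ?thesis
      unfolding X_def X'_def
      using k by (intro block_sum_mult_vec_cong[OF blocks_mono[OF Vb ks] blocks_mono[OF Ub ks]
            blocks_mono[OF vb ks] blocks_mono[OF ub ks] b] termV) simp
  qed
  \<comment> \<open>Every image below is the projection of \<open>b\<close> onto the first \<open>k\<close> left blocks,
    whether the blocks are \<open>Uh\<close> or \<open>u\<close>.\<close>
  define pb where "pb k = block_sum m m (\<lambda>i. \<sigma> i * (1 / \<sigma> i)) Uh Uh k *\<^sub>v b" for k
  \<comment> \<open>The length \<open>l\<close> is kept apart from \<open>k\<close>:
    \<open>l = k\<close> yields the truncated matrices and \<open>l = s\<close> the full
    ones.\<close>
  have images: "block_sum m n \<sigma> Uh Vh l *\<^sub>v (X k *\<^sub>v b) = pb k"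
      "block_sum m n \<sigma> u1 v1 l *\<^sub>v (X k *\<^sub>v b) = pb k"
    if k: "k \<in> {1..s}" and kl: "k \<le> l" and ls: "l \<le> s" for k l
  proof -
    have ks: "k \<le> s" using k by simp
    note Ul = orthonormal_blocks_mono[OF Uo ls] and Vl = orthonormal_blocks_mono[OF Vo ls]
      and ul = orthonormal_blocks_mono[OF uo ls] and vl = orthonormal_blocks_mono[OF vo ls]
    note Ulb = orthonormal_blocksD[OF Ul] and Vlb = orthonormal_blocksD[OF Vl]
      and ulb = orthonormal_blocksD[OF ul] and vlb = orthonormal_blocksD[OF vl]
    have "block_sum m n \<sigma> Uh Vh l *\<^sub>v (X k *\<^sub>v b) = (block_sum m n \<sigma> Uh Vh l * X k) *\<^sub>v b"
      by (rule assoc_mult_mat_vec[symmetric, OF block_sum_carrier[OF Ulb Vlb] Xc[OF k] b])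
    also have "\<dots> = pb k"
      unfolding X_def pb_def block_sum_mult[OF Ulb Vl Ulb kl] ..
    finally show "block_sum m n \<sigma> Uh Vh l *\<^sub>v (X k *\<^sub>v b) = pb k" .
    \<comment> \<open>The solution is first rewritten with \<open>X' k\<close>, so that the inner
      families of the product are both \<open>v1\<close> and \<open>block_sum_mult\<close>
      applies.\<close>
    have "block_sum m n \<sigma> u1 v1 l *\<^sub>v (X k *\<^sub>v b) = (block_sum m n \<sigma> u1 v1 l * X' k) *\<^sub>v b"
      unfolding XX'[OF k]
      by (rule assoc_mult_mat_vec[symmetric, OF block_sum_carrier[OF ulb vlb] X'c[OF k] b])
    also have "\<dots> = block_sum m m (\<lambda>i. \<sigma> i * (1 / \<sigma> i)) u1 u1 k *\<^sub>v b"
      unfolding X'_def block_sum_mult[OF ulb vl ulb kl] ..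
    also have "\<dots> = pb k"
      unfolding pb_def using k
      by (intro block_sum_mult_vec_cong[OF blocks_mono[OF ub ks] blocks_mono[OF ub ks]
            blocks_mono[OF Ub ks] blocks_mono[OF Ub ks] b] termU[symmetric]) simp
    finally show "block_sum m n \<sigma> u1 v1 l *\<^sub>v (X k *\<^sub>v b) = pb k" .
  qed
  have ss: "s \<in> {1..s}" using s by simp
  have pk: "pinv (Ak k) = X k" "pinv (A'k k) = X' k" if "k \<in> {1..s}" for k
    using pinv_eqI mp[OF that] mp'[OF that] by auto
  \<comment> \<open>Truncation at \<open>s\<close> removes nothing, so the naive solution is the
    case \<open>k = s\<close>.\<close>
  have AAk: "A = Ak s" "A' = A'k s" unfolding A_eq A'_eq Ak'[OF ss] A'k'[OF ss] by simp_all
  have sol: "min_norm_lsq_sol (Ak k) b = X k *\<^sub>v b" "min_norm_lsq_sol (A'k k) b = X k *\<^sub>v b"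
    "\<exists>!x. min_norm_lsq (Ak k) b x" "\<exists>!x. min_norm_lsq (A'k k) b x"
    if k: "k \<in> {1..s}" for k
    using min_norm_lsq_sol_eq_pinv[OF Akc[OF k] mp[OF k] b]
      min_norm_lsq_sol_eq_pinv[OF A'kc[OF k] mp'[OF k] b]
    by (simp_all add: pk[OF k] XX'[OF k])
  have im: "A *\<^sub>v (X k *\<^sub>v b) = pb k" "Ak k *\<^sub>v (X k *\<^sub>v b) = pb k"
    "A'k k *\<^sub>v (X k *\<^sub>v b) = pb k" "A' *\<^sub>v (X k *\<^sub>v b) = pb k"
    if k: "k \<in> {1..s}" for k
    unfolding A_eq Ak'[OF k] A'k'[OF k] A'_eq using k by (auto intro: images)
  have full: "pinv A *\<^sub>v b = X s *\<^sub>v b" "pinv A' *\<^sub>v b = X s *\<^sub>v b"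
    unfolding AAk pk[OF ss] XX'[OF ss] by (rule refl)+
  have x: "x_tsvd k = X k *\<^sub>v b" if k: "k \<in> {1..s}" for k
    unfolding x_tsvd[OF k] by (rule sol(1)[OF k])
  show ?thesis
    using sol(3,4)
    by (simp add: x x_naive full sol(1,2) pk im ss XX'[symmetric]
        del: atLeastAtMost_iff One_nat_def)
qed

end
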